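(* Let $U_1,\dots,U_m\subset\mathbb{R}^n$ be closed convex sets with intersection $U:=\bigcap_{i=1}^m U_i$. Assume that $\operatorname{int}(U)\neq\emptyset$ and that each boundary $\partial U_i$ is locally a differentiable manifold. Let $(x_k)_{k\ge1}$ be the sequence generated by 3PM for a starting point $x_1\in\mathbb{R}^n$, which converges to $\bar x$. Define $I=\{i\in\{1,\dots,m\}:\bar x\notin\operatorname{int}(U_i)\}$, and assume that $x_k\notin\bigcup_{i\in I}U_i$ for all $k$ large enough. Then $(x_k)$ converges to $\bar x$ superlinearly.
   Context: $\mathbb{R}^n$ carries the Euclidean inner product and norm; $P_C(x)$ is the projection of $x$ onto a nonempty closed convex set $C$. The sequence generated by 3PM (Parallel Polyhedral Projection Method) from $x_1$ is defined recursively for $k\ge1$ by $$S_{ik}=\{z\in\mathbb{R}^n:\langle x_k-P_{U_i}(x_k),\,z-P_{U_i}(x_k)\rangle\le 0\}\ (i=1,\dots,m),\quad \Omega_k=\bigcap_{i=1}^m S_{ik},\quad x_{k+1}=P_{\Omega_k}(x_k).$$ (If $x_k\in U$, then $x_{k+1}=x_k$, so the sequence is constant from then on.) Every such sequence converges to a point of $U$. "$\partial U_i$ is locally a differentiable manifold" means that it is a $C^1$ submanifold of $\mathbb{R}^n$, necessarily of dimension $n-1$ here: every $\bar z\in\partial U_i$ has an open ball $B\ni\bar z$ and a $C^1$ function $g:B\to\mathbb{R}$ with nowhere vanishing gradient such that $\partial U_i\cap B=\{z\in B: g(z)=0\}$. Superlinear convergence of $(x_k)$ to $\bar x$ means $\lim_{k\to\infty}\|x_{k+1}-\bar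 x\|/\|x_k-\bar x\|=0$, i.e. for every $\eta>0$ one has $\|x_{k+1}-\bar x\|\le\eta\|x_k-\bar x\|$ for all sufficiently large $k$ (this form also covers the case where $x_k=\bar x$ eventually). *)

theory Defs
  imports "HOL-Analysis.Analysis"
begin

text \<open>
  The notion of a \<open>C\<^sup>1\<close> submanifold of codimension one, stated through local defining functions.
  Only the values of \<open>g\<close> and of its gradient \<open>D\<close> on the open ball matter.
\<close>

definition C1_hypersurface :: "(real^'n) set \<Rightarrow> bool" where
  "C1_hypersurface M \<longleftrightarrow>
     (\<forall>p\<in>M. \<exists>c r (g :: real^'n \<Rightarrow> real) D.
        p \<in> ball c r \<and>
        (\<forall>z\<in>ball c r. GDERIV g z :> D z) \<and>
        continuous_on (ball c r) D \<and>
        (\<forall>z\<in>ball c r. D z \<noteq> 0) \<and>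
        M \<inter> ball c r = {z \<in> ball c r. g z = 0})"

text \<open>
  One step of the parallel polyhedral projection method.  \<open>S_3PM C x\<close> is the half-space cut out at
  the projection of \<open>x\<close> onto \<open>C\<close>; it is the whole space when \<open>x \<in> C\<close>.  All projections in this
  file are onto nonempty closed convex sets as soon as the sets \<open>U i\<close> are closed and convex with
  a common point, so that \<^const>\<open>closest_point\<close> is the metric projection.
\<close>

definition S_3PM :: "(real^'n) set \<Rightarrow> real^'n \<Rightarrow> (real^'n) set" where
  "S_3PM C x = {z. (x - closest_point C x) \<bullet> (z - closest_point C x) \<le> 0}"

definition \<Omega>_3PM :: "nat \<Rightarrow> (nat \<Rightarrow> (real^'n) set) \<Rightarrow> real^'n \<Rightarrow> (real^'n) set" where
  "\<Omega>_3PM m U x = (\<Inter>i\<in>{1..m}. S_3PM (U i) x)"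

text \<open>Sequences are indexed from 1; the value at index 0 is irrelevant.\<close>

definition generated_by_3PM ::
  "nat \<Rightarrow> (nat \<Rightarrow> (real^'n) set) \<Rightarrow> real^'n \<Rightarrow> (nat \<Rightarrow> real^'n) \<Rightarrow> bool" where
  "generated_by_3PM m U start x \<longleftrightarrow>
     x 1 = start \<and> (\<forall>k\<ge>1. x (Suc k) = closest_point (\<Omega>_3PM m U (x k)) (x k))"

text \<open>The quotient-free form also covers sequences that reach their limit after finitely many steps.\<close>

definition superlinearly_convergent :: "(nat \<Rightarrow> real^'n) \<Rightarrow> real^'n \<Rightarrow> bool" where
  "superlinearly_convergent x l \<longleftrightarrow>
     (\<forall>\<eta>>0. \<forall>\<^sub>F k in sequentially. norm (x (Suc k) - l) \<le> \<eta> * norm (x k - l))"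

end

theory Submission
  imports Defs
begin

text \<open>
  For \<open>i \<in> I\<close> let \<open>n\<^sub>k\<close> be the unit outer normal of \<open>U i\<close> at the projection of \<open>x k\<close>.  Smoothness of
  the boundary makes the unit normal at \<open>xbar\<close> unique, so by compactness of the sphere \<open>n\<^sub>k\<close> converges.
  Since \<open>x (k + 1)\<close> satisfies the linearized constraint, convexity of the distance function bounds the
  distance of \<open>x (k + 1)\<close> to \<open>U i\<close> by \<open>(n\<^bsub>k+1\<^esub> - n\<^sub>k) \<bullet> (x (k + 1) - x k)\<close>, which is therefore
  \<open>o(norm (x (k + 1) - x k))\<close>.  An interior point of the intersection turns this into the same bound for the
  distance to the intersection, and Fejer monotonicity turns that into a bound for the distance to \<open>xbar\<close>.
  Finally \<open>norm (x (k + 1) - x k) \<le> norm (x k - xbar)\<close>, because \<open>xbar\<close> lies in the polyhedron projected onto.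
\<close>

section \<open>Smooth boundaries and uniqueness of the unit normal\<close>

text \<open>
  \<open>M\<close> contains points on almost tangential short segments from \<open>p\<close>; the intermediate value theorem
  gives this without an implicit function theorem.
\<close>

lemma C1_hypersurface_secant:
  fixes M :: "(real^'n) set"
  assumes "C1_hypersurface M" "p \<in> M"
  obtains d where "d \<noteq> 0"
    "\<And>w e. w \<bullet> d = 0 \<Longrightarrow> e > 0 \<Longrightarrow> \<exists>t>0. \<exists>s. \<bar>s\<bar> \<le> e \<and> p + t *\<^sub>R (w + s *\<^sub>R d) \<in> M"
proof -
  obtain c r g D where p: "p \<in> ball c r"
    and D: "\<And>z. z \<in> ball c r \<Longrightarrow> GDERIV g z :> D z"
    and nz: "\<And>z. z \<in> ball c r \<Longrightarrow> D z \<noteq> 0"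
    and M: "M \<inter> ball c r = {z \<in> ball c r. g z = 0}"
    using assms(1)[unfolded C1_hypersurface_def, rule_format, OF assms(2)] by blast
  define d where "d = D p"
  have d0: "d \<noteq> 0" using nz[OF p] by (simp add: d_def)
  have gp: "g p = 0" using M p assms(2) by blast
  have contg: "continuous_on (ball c r) g"
    by (meson D continuous_at_imp_continuous_on gderiv_def has_derivative_continuous)
  have dir: "((\<lambda>t. g (p + t *\<^sub>R v)) has_real_derivative (v \<bullet> d)) (at 0)" for v
  proof -
    have 1: "((\<lambda>t::real. p + t *\<^sub>R v) has_derivative (\<lambda>t. t *\<^sub>R v)) (at 0)"
      by (auto intro!: derivative_eq_intros)
    have 2: "(g has_derivative (\<lambda>h. h \<bullet> d)) (at (p + 0 *\<^sub>R v))"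
      using D[OF p] by (simp add: gderiv_def d_def)
    have "(*) (v \<bullet> d) = (\<lambda>t. (t *\<^sub>R v) \<bullet> d)" by (simp add: fun_eq_iff)
    then show ?thesis
      using has_derivative_compose[OF 1 2] by (simp only: has_field_derivative_def)
  qed
  have "\<exists>t>0. \<exists>s. \<bar>s\<bar> \<le> e \<and> p + t *\<^sub>R (w + s *\<^sub>R d) \<in> M" if w: "w \<bullet> d = 0" and e: "e > 0" for w e
  proof -
    have dd: "d \<bullet> d > 0" using d0 by simp
    \<comment> \<open>At \<open>p\<close> the derivatives of \<open>g\<close> along
      \<open>w + e d\<close> and \<open>w - e d\<close> are \<open>e\<close> and \<open>-e\<close>
      times \<open>d \<bullet> d\<close>, so \<open>g\<close> takes opposite signs at the two ends
      of a short transversal segment.\<close>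
    have "(w + e *\<^sub>R d) \<bullet> d > 0" "(w + (- e) *\<^sub>R d) \<bullet> d < 0"
      using w e dd by (auto simp: inner_add_left inner_diff_left)
    then obtain a b where a: "a > 0" "\<And>h. 0 < h \<Longrightarrow> h < a \<Longrightarrow> 0 < g (p + h *\<^sub>R (w + e *\<^sub>R d))"
      and b: "b > 0" "\<And>h. 0 < h \<Longrightarrow> h < b \<Longrightarrow> g (p + h *\<^sub>R (w + (- e) *\<^sub>R d)) < 0"
      using DERIV_pos_inc_right[OF dir, of "w + e *\<^sub>R d"]
        DERIV_neg_dec_right[OF dir, of "w + (- e) *\<^sub>R d"] gp by auto
    obtain \<rho> where \<rho>: "\<rho> > 0" "ball p \<rho> \<subseteq> ball c r"
      using p open_contains_ball[of "ball c r"] open_ball by blast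
    \<comment> \<open>\<open>K\<close> bounds the norm of \<open>w + s d\<close> for
      \<open>\<bar>s\<bar> \<le> e\<close>, so \<open>t < \<rho> / K\<close> keeps the whole segment
      in the ball; the summand 1 keeps \<open>K\<close> positive.\<close>
    define K where "K = norm w + e * norm d + 1"
    have K: "K > 0" using e by (simp add: K_def add_nonneg_pos)
    have "\<rho> / K > 0" using \<rho>(1) K by simp
    then have "0 < min (min a b) (\<rho> / K)" using a(1) b(1) by simp
    then obtain t where "0 < t" "t < min (min a b) (\<rho> / K)" by (rule dense[THEN exE]) blast
    then have t: "0 < t" "t < a" "t < b" "t < \<rho> / K" by simp_all
    have inb: "p + t *\<^sub>R (w + s *\<^sub>R d) \<in> ball c r" if "s \<in> {-e..e}" for s
    proof -
      have "norm (w + s *\<^sub>R d) \<le> norm w + \<bar>s\<bar> * norm d"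
        by (metis norm_scaleR norm_triangle_ineq)
      also have "\<dots> \<le> K"
        using that mult_right_mono[of "\<bar>s\<bar>" e "norm d"] unfolding K_def by (auto simp: abs_le_iff)
      finally have "t * norm (w + s *\<^sub>R d) \<le> t * K" using t(1) by simp
      also have "\<dots> < \<rho>" using t(4) K by (simp add: field_simps)
      finally have "p + t *\<^sub>R (w + s *\<^sub>R d) \<in> ball p \<rho>"
        using t(1) by (simp add: dist_norm)
      then show ?thesis using \<rho> by blast
    qed
    have "continuous_on {-e..e} (\<lambda>s. g (p + t *\<^sub>R (w + s *\<^sub>R d)))"
      by (rule continuous_on_compose2[OF contg]) (use inb in \<open>auto intro!: continuous_intros\<close>)
    then obtain s where "s \<in> {-e..e}" "g (p + t *\<^sub>R (w + s *\<^sub>R d)) = 0"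
      using IVT'[of "\<lambda>s. g (p + t *\<^sub>R (w + s *\<^sub>R d))" "-e" 0 e] a(2)[OF t(1,2)] b(2)[OF t(1,3)] e
      by force
    moreover from this have "p + t *\<^sub>R (w + s *\<^sub>R d) \<in> M" using inb[of s] M by blast
    ultimately show ?thesis using t(1) by (intro exI[of _ t] conjI exI[of _ s]) auto
  qed
  then show thesis using that d0 by blast
qed

text \<open>Testing a normal on the secant points kills its component orthogonal to
  \<open>d\<close>, so it is \<open>d / norm d\<close> up to sign. Two opposite normals would
  confine \<open>C\<close> to a hyperplane, which the nonempty interior forbids.\<close>

lemma unit_normal_unique:
  fixes C :: "(real^'n) set"
  assumes C1: "C1_hypersurface (frontier C)" and "closed C" and int: "interior C \<noteq> {}"
    and p: "p \<in> frontier C"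
    and u: "norm u = 1" "\<And>z. z \<in> C \<Longrightarrow> u \<bullet> (z - p) \<le> 0"
    and v: "norm v = 1" "\<And>z. z \<in> C \<Longrightarrow> v \<bullet> (z - p) \<le> 0"
  shows "u = v"
proof -
  obtain d where d0: "d \<noteq> 0" and d: "\<And>w e. w \<bullet> d = 0 \<Longrightarrow> e > 0 \<Longrightarrow>
      \<exists>t>0. \<exists>s. \<bar>s\<bar> \<le> e \<and> p + t *\<^sub>R (w + s *\<^sub>R d) \<in> frontier C"
    using C1_hypersurface_secant[OF C1 p] by metis
  have sub: "frontier C \<subseteq> C" using \<open>closed C\<close> by (simp add: frontier_subset_closed)
  have par: "\<bar>n \<bullet> d\<bar> = norm d \<and> n = ((n \<bullet> d) / (d \<bullet> d)) *\<^sub>R d"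
    if n: "norm n = 1" "\<And>z. z \<in> C \<Longrightarrow> n \<bullet> (z - p) \<le> 0" for n
  proof -
    define w where "w = n - ((n \<bullet> d) / (d \<bullet> d)) *\<^sub>R d"
    have wd: "w \<bullet> d = 0" using d0 by (simp add: w_def inner_diff_left)
    have "n \<bullet> w \<le> 0 + e" if e: "e > 0" for e
    proof -
      \<comment> \<open>With this tolerance the error term \<open>s * (n \<bullet> d)\<close> is at
        most \<open>e\<close> in absolute value.\<close>
      have "e / norm d > 0" using e d0 by simp
      from d[OF wd this] obtain t s where t: "t > 0" "\<bar>s\<bar> \<le> e / norm d"
        "p + t *\<^sub>R (w + s *\<^sub>R d) \<in> frontier C" by blast
      have "n \<bullet> (t *\<^sub>R (w + s *\<^sub>R d)) \<le> 0" using n(2)[of "p + t *\<^sub>R (w + s *\<^sub>R d)"] t(3) sub by auto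
      then have "n \<bullet> w + s * (n \<bullet> d) \<le> 0" using t(1)
        by (simp add: inner_add_right mult_le_0_iff)
      moreover have "\<bar>s * (n \<bullet> d)\<bar> \<le> e / norm d * norm d"
        unfolding abs_mult using t(2) Cauchy_Schwarz_ineq2[of n d] n(1) by (intro mult_mono) auto
      ultimately show ?thesis using d0 by auto
    qed
    then have "n \<bullet> w \<le> 0" using field_le_epsilon by blast
    moreover have "n = w + ((n \<bullet> d) / (d \<bullet> d)) *\<^sub>R d" by (simp add: w_def)
    then have "n \<bullet> w = w \<bullet> w"
      by (metis wd add.right_neutral inner_add_left inner_commute inner_scaleR_left mult_zero_right)
    ultimately have "w = 0" by (metis inner_ge_zero inner_eq_zero_iff order_antisym)
    then have eq: "n = ((n \<bullet> d) / (d \<bullet> d)) *\<^sub>R d" by (simp add: w_def)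
    then have "1 = \<bar>n \<bullet> d\<bar> / (d \<bullet> d) * norm d" using n(1)
      by (metis abs_divide abs_of_nonneg inner_ge_zero norm_scaleR)
    then have "\<bar>n \<bullet> d\<bar> = norm d" using d0
      by (simp add: dot_square_norm power2_eq_square field_simps)
    then show ?thesis using eq by blast
  qed
  have "v \<bullet> d = u \<bullet> d \<or> v \<bullet> d = - (u \<bullet> d)"
    using par[OF u] par[OF v] by linarith
  then consider "v = u" | "v = - u"
    using par[OF u] par[OF v] by (metis minus_divide_left scaleR_minus_left)
  then show ?thesis
  proof cases
    case 2
    \<comment> \<open>Opposite normals make \<open>u \<bullet> (z - p)\<close> vanish on all of
      \<open>C\<close>, yet a move along \<open>u\<close> inside a ball in \<open>C\<close> changes
      it by \<open>e\<close>.\<close>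
    obtain z e where e: "e > 0" "cball z e \<subseteq> C" using int
      by (meson ex_in_conv mem_interior_cball)
    have "z + e *\<^sub>R u \<in> C" "z \<in> C" using e u(1) by (auto simp: subset_iff dist_norm)
    then have "u \<bullet> (z + e *\<^sub>R u - p) \<le> 0" "- (u \<bullet> (z - p)) \<le> 0"
      using u(2) v(2) 2 by fastforce+
    moreover have "u \<bullet> (z + e *\<^sub>R u - p) = u \<bullet> (z - p) + e"
      using u(1) by (simp add: inner_add_right inner_diff_right dot_square_norm)
    ultimately show ?thesis using e(1) by linarith
  qed auto
qed

section \<open>Convergence of the unit normals\<close>

lemma compact_unique_cluster_tendsto:
  fixes f :: "nat \<Rightarrow> 'a::metric_space"
  assumes "compact K" "\<And>k. f k \<in> K"
    and uniq: "\<And>r l. strict_mono r \<Longrightarrow> (f \<circ> r) \<longlonglongrightarrow> l \<Longrightarrow> l = u"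
  shows "f \<longlonglongrightarrow> u"
proof (rule ccontr)
  assume "\<not> f \<longlonglongrightarrow> u"
  then obtain e where e: "e > 0" "\<not> (\<forall>\<^sub>F k in sequentially. dist (f k) u < e)"
    by (auto simp: tendsto_iff)
  then have "infinite {k. \<not> dist (f k) u < e}"
    unfolding cofinite_eq_sequentially[symmetric] eventually_cofinite by blast
  from infinite_enumerate[OF this]
  obtain r :: "nat \<Rightarrow> nat" where r: "strict_mono r" "\<And>k. \<not> dist (f (r k)) u < e"
    by auto
  have "\<forall>k. (f \<circ> r) k \<in> K" using assms(2) by simp
  then obtain l q where q: "strict_mono q" "(f \<circ> r \<circ> q) \<longlonglongrightarrow> l"
    using assms(1) unfolding compact_def by blast
  then have "l = u" using uniq[of "r \<circ> q" l] r(1) by (simp add: comp_assoc strict_mono_o)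
  then have "\<forall>\<^sub>F k in sequentially. dist ((f \<circ> r \<circ> q) k) u < e"
    using q(2) e(1) tendstoD by blast
  then show False using r(2) by (auto simp: eventually_sequentially)
qed

text \<open>The normal inequality passes to limits, so every cluster point of \<open>n\<close> is a
  unit normal of \<open>C\<close> at \<open>p\<close>, and there is only one of these.\<close>

lemma unit_normals_tendsto:
  fixes C :: "(real^'n) set"
  assumes C1: "C1_hypersurface (frontier C)" and cl: "closed C" and int: "interior C \<noteq> {}"
    and p: "p \<in> frontier C" and q: "q \<longlonglongrightarrow> p"
    and n: "\<And>k. norm (n k) = 1" "\<And>k z. z \<in> C \<Longrightarrow> n k \<bullet> (z - q k) \<le> 0"
  obtains u where "n \<longlonglongrightarrow> u"
proof -
  have K: "compact (sphere 0 1 :: (real^'n) set)" "\<And>k. n k \<in> sphere 0 1" using n(1) by auto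
  have lim: "norm l = 1 \<and> (\<forall>z\<in>C. l \<bullet> (z - p) \<le> 0)" if r: "strict_mono r" "(n \<circ> r) \<longlonglongrightarrow> l" for r l
  proof (intro conjI ballI)
    have "(\<lambda>k. norm ((n \<circ> r) k)) \<longlonglongrightarrow> norm l" using r(2) by (rule tendsto_norm)
    then show "norm l = 1" by (simp add: n(1) LIMSEQ_const_iff)
    fix z assume "z \<in> C"
    have "(\<lambda>k. (n \<circ> r) k \<bullet> (z - (q \<circ> r) k)) \<longlonglongrightarrow> l \<bullet> (z - p)"
      by (intro tendsto_intros r LIMSEQ_subseq_LIMSEQ q)
    then show "l \<bullet> (z - p) \<le> 0"
      by (rule LIMSEQ_le_const2) (use n(2) \<open>z \<in> C\<close> in auto)
  qed
  obtain u r where r: "strict_mono r" "(n \<circ> r) \<longlonglongrightarrow> u"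
    using K unfolding compact_def by blast
  have "n \<longlonglongrightarrow> u"
  proof (rule compact_unique_cluster_tendsto[OF K])
    fix r' l assume "strict_mono r'" "(n \<circ> r') \<longlonglongrightarrow> l"
    from lim[OF this] lim[OF r] show "l = u" by (intro unit_normal_unique[OF C1 cl int p]) auto
  qed
  then show thesis by (rule that)
qed

section \<open>Distance to one set and to the intersection\<close>

lemma closest_point_unit_normal_le:
  fixes C :: "'a::euclidean_space set"
  assumes "convex C" "closed C" "z \<in> C"
  shows "sgn (a - closest_point C a) \<bullet> (z - closest_point C a) \<le> 0"
  using closest_point_dot[OF assms, of a] by (simp add: sgn_div_norm mult_nonneg_nonpos)

text \<open>The new normal measures the distance from \<open>y\<close> exactly, while the old one is
  nonpositive on \<open>y - p\<close>. Comparing the two along the step leaves only the change of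
  the normal.\<close>

lemma dist_closest_point_step:
  fixes C :: "(real^'n) set"
  assumes C: "convex C" "closed C" "C \<noteq> {}" and "x \<notin> C" "y \<notin> C" and y: "y \<in> S_3PM C x"
  shows "dist y (closest_point C y) \<le>
    norm (sgn (y - closest_point C y) - sgn (x - closest_point C x)) * norm (y - x)"
proof -
  define p q where "p = closest_point C x" and "q = closest_point C y"
  define n n' where "n = sgn (x - p)" and "n' = sgn (y - q)"
  have pq: "p \<in> C" "q \<in> C" using C by (auto simp: p_def q_def closest_point_in_set)
  then have ne: "x \<noteq> p" "y \<noteq> q" using assms by auto
  have nn: "norm n' = 1" using ne by (simp add: n'_def norm_sgn)
  have self: "sgn v \<bullet> v = norm v" for v :: "real^'n"
    by (cases "v = 0") (simp_all add: sgn_div_norm dot_square_norm power2_eq_square)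
  have "n \<bullet> (y - p) \<le> 0"
    using y by (simp add: S_3PM_def p_def n_def sgn_div_norm mult_nonneg_nonpos)
  moreover have "n' \<bullet> (p - q) \<le> 0"
    unfolding n'_def q_def by (rule closest_point_unit_normal_le) (use C pq in auto)
  \<comment> \<open>Among unit vectors, \<open>n\<close> has the largest inner product with
    \<open>x - p\<close>.\<close>
  moreover have "n' \<bullet> (x - p) \<le> n \<bullet> (x - p)"
    using norm_cauchy_schwarz[of n' "x - p"] nn by (simp add: n_def self)
  moreover have "norm (y - q) = n' \<bullet> (y - q)" by (simp add: n'_def self)
  ultimately have "norm (y - q) \<le> (n' - n) \<bullet> (y - x)"
    by (simp add: inner_diff_left inner_diff_right)
  also have "\<dots> \<le> norm (n' - n) * norm (y - x)" by (rule norm_cauchy_schwarz)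
  finally show ?thesis by (simp add: dist_norm n_def n'_def p_def q_def)
qed

text \<open>Moving from \<open>x\<close> towards the centre of the inscribed ball until all constraints hold.\<close>

lemma linear_regularity:
  fixes U :: "'i \<Rightarrow> 'a::euclidean_space set"
  assumes cvx: "\<And>i. i \<in> J \<Longrightarrow> convex (U i)" and "\<And>i. i \<in> J \<Longrightarrow> closed (U i)"
    and r: "r > 0" "cball z r \<subseteq> (\<Inter>i\<in>J. U i)"
    and \<delta>: "\<delta> \<ge> 0" "\<And>i. i \<in> J \<Longrightarrow> dist x (closest_point (U i) x) \<le> \<delta>"
  obtains y where "y \<in> (\<Inter>i\<in>J. U i)" "norm (x - y) \<le> \<delta> / r * norm (x - z)"
proof -
  \<comment> \<open>This weight balances an error \<open>\<delta>\<close> at \<open>x\<close>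
    against room \<open>r\<close> at \<open>z\<close>:
    \<open>t * \<delta> = (1 - t) * r\<close>.\<close>
  define t where "t = r / (r + \<delta>)"
  have t: "0 < t" "t \<le> 1" "1 - t = \<delta> / (r + \<delta>)" using r(1) \<delta>(1) by (auto simp: t_def field_simps)
  define y where "y = t *\<^sub>R x + (1 - t) *\<^sub>R z"
  have "y \<in> U i" if i: "i \<in> J" for i
  proof -
    define p where "p = closest_point (U i) x"
    have z: "cball z r \<subseteq> U i" using r i by blast
    then have ne: "U i \<noteq> {}" using r(1) by force
    have p: "p \<in> U i" using ne assms(2)[OF i] by (simp add: p_def closest_point_in_set)
    have d: "norm (x - p) \<le> \<delta>" using \<delta>(2)[OF i] by (simp add: dist_norm p_def)
    show ?thesis
    proof (cases "\<delta> = 0")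
      case True
      then show ?thesis using p d t by (simp add: y_def)
    next
      case False
      then have \<delta>0: "\<delta> > 0" using \<delta>(1) by simp
      \<comment> \<open>Shifting \<open>z\<close> within its ball absorbs the error of replacing
        \<open>x\<close> by \<open>p\<close>, so \<open>y\<close> is also a convex combination of
        the two points \<open>p\<close> and \<open>q\<close> of \<open>U i\<close>.\<close>
      define q where "q = z + (r / \<delta>) *\<^sub>R (x - p)"
      have "norm ((r / \<delta>) *\<^sub>R (x - p)) \<le> r"
        using mult_left_mono[OF d, of "r / \<delta>"] r(1) \<delta>0 by (simp del: scaleR_diff_right)
      then have "q \<in> U i" using z by (auto simp: q_def dist_norm subset_iff)
      moreover have "(1 - t) * (r / \<delta>) = t" using \<delta>0 t(3) by (simp add: t_def)
      then have "y = t *\<^sub>R p + (1 - t) *\<^sub>R q"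
        by (simp add: y_def q_def scaleR_add_right scaleR_diff_right)
      ultimately show ?thesis
        using convexD[OF cvx[OF i] p, of q t "1 - t"] t by simp
    qed
  qed
  moreover have "x - y = (1 - t) *\<^sub>R (x - z)" by (simp add: y_def algebra_simps)
  then have "norm (x - y) = \<delta> / (r + \<delta>) * norm (x - z)"
    using t r(1) \<delta>(1) by simp
  moreover have "\<delta> / (r + \<delta>) \<le> \<delta> / r" using r(1) \<delta>(1) by (intro divide_left_mono) auto
  ultimately show thesis
    using mult_right_mono[of "\<delta> / (r + \<delta>)" "\<delta> / r" "norm (x - z)"] by (intro that[of y]) auto
qed

section \<open>The polyhedra of 3PM\<close>

lemma closed_S_3PM: "closed (S_3PM C x)"
  and convex_S_3PM: "convex (S_3PM C x)"
proof -
  have "S_3PM C x = {z. (x - closest_point C x) \<bullet> z \<le> (x - closest_point C x) \<bullet> closest_point C x}"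
    by (auto simp: S_3PM_def inner_diff_right)
  then show "closed (S_3PM C x)" "convex (S_3PM C x)"
    by (simp_all add: closed_halfspace_le convex_halfspace_le)
qed

lemma closed_\<Omega>_3PM: "closed (\<Omega>_3PM m U x)"
  and convex_\<Omega>_3PM: "convex (\<Omega>_3PM m U x)"
  unfolding \<Omega>_3PM_def by (auto intro!: closed_INT convex_INT closed_S_3PM convex_S_3PM)

text \<open>By the obtuse-angle property of projections each cut contains its set. Hence every
  common point can serve as a comparison point in a projection step.\<close>

lemma Inter_subset_\<Omega>_3PM:
  assumes "\<And>i. i \<in> {1..m} \<Longrightarrow> closed (U i)" "\<And>i. i \<in> {1..m} \<Longrightarrow> convex (U i)"
  shows "(\<Inter>i\<in>{1..m}. U i) \<subseteq> \<Omega>_3PM m U x"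
  using closest_point_dot assms unfolding \<Omega>_3PM_def S_3PM_def by blast

text \<open>The obtuse angle at the projection turns Pythagoras into an inequality. It yields both
  Fejer monotonicity and the bound on the step length.\<close>

lemma dist_closest_point_sq:
  fixes C :: "'a::euclidean_space set"
  assumes "convex C" "closed C" "z \<in> C"
  shows "(norm (closest_point C x - z))\<^sup>2 + (norm (x - closest_point C x))\<^sup>2 \<le> (norm (x - z))\<^sup>2"
proof -
  define p where "p = closest_point C x"
  have "(x - p) \<bullet> (z - p) \<le> 0" unfolding p_def by (rule closest_point_dot[OF assms])
  then have "(norm (p - z))\<^sup>2 + (norm (x - p))\<^sup>2 \<le> (norm (x - z))\<^sup>2"
    unfolding power2_norm_eq_inner by (simp add: algebra_simps inner_commute)
  then show ?thesis by (simp add: p_def)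
qed

section \<open>Superlinear convergence of 3PM\<close>

theorem theorem2p12:
  fixes m :: nat and U :: "nat \<Rightarrow> (real^'n) set"
    and x :: "nat \<Rightarrow> real^'n" and x\<^sub>1 xbar :: "real^'n"
    and I :: "nat set"
  assumes "1 \<le> m"
    and "\<And>i. i \<in> {1..m} \<Longrightarrow> closed (U i)"
    and "\<And>i. i \<in> {1..m} \<Longrightarrow> convex (U i)"
    and "interior (\<Inter>i\<in>{1..m}. U i) \<noteq> {}"
    and "\<And>i. i \<in> {1..m} \<Longrightarrow> C1_hypersurface (frontier (U i))"
    and "generated_by_3PM m U x\<^sub>1 x"
    and "x \<longlonglongrightarrow> xbar"
    and "I = {i \<in> {1..m}. xbar \<notin> interior (U i)}"
    and "\<forall>\<^sub>F k in sequentially. x k \<notin> (\<Union>i\<in>I. U i)"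
  shows "superlinearly_convergent x xbar"
proof -
  note cl = assms(2) and cvx = assms(3) and lim = assms(7) and I = assms(8)
  let ?V = "\<Inter>i\<in>{1..m}. U i"
  let ?P = "\<lambda>i. closest_point (U i)"
  obtain z r where r: "r > 0" "cball z r \<subseteq> ?V"
    using assms(4) by (meson ex_in_conv mem_interior_cball)
  have intU: "interior (U i) \<noteq> {}" and neU: "U i \<noteq> {}" if "i \<in> {1..m}" for i
  proof -
    have "?V \<subseteq> U i" using that by blast
    then show "interior (U i) \<noteq> {}" using assms(4) interior_mono by blast
    then show "U i \<noteq> {}" by auto
  qed
  have step: "x (Suc k) = closest_point (\<Omega>_3PM m U (x k)) (x k)" if "k \<ge> 1" for k
    using assms(6) that by (simp add: generated_by_3PM_def)
  have Vsub: "?V \<subseteq> \<Omega>_3PM m U y" for y using cl cvx by (rule Inter_subset_\<Omega>_3PM)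
  have neV: "z \<in> ?V" using r by (simp add: subset_iff)
  have inS: "x (Suc k) \<in> S_3PM (U i) (x k)" if "k \<ge> 1" "i \<in> {1..m}" for k i
  proof -
    have "\<Omega>_3PM m U (x k) \<noteq> {}" using Vsub neV by blast
    then have "x (Suc k) \<in> \<Omega>_3PM m U (x k)"
      unfolding step[OF that(1)] by (intro closest_point_in_set closed_\<Omega>_3PM)
    then show ?thesis using that(2) by (auto simp: \<Omega>_3PM_def)
  qed
  have sq: "(norm (x (Suc k) - y))\<^sup>2 + (norm (x k - x (Suc k)))\<^sup>2 \<le> (norm (x k - y))\<^sup>2"
    if "k \<ge> 1" "y \<in> ?V" for k y
    unfolding step[OF that(1)]
    by (rule dist_closest_point_sq[OF convex_\<Omega>_3PM closed_\<Omega>_3PM]) (use Vsub that in blast)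
  have fejer: "norm (x (Suc k) - y) \<le> norm (x k - y)"
    and move: "norm (x (Suc k) - x k) \<le> norm (x k - y)" if "k \<ge> 1" "y \<in> ?V" for k y
  proof -
    have "(norm (x (Suc k) - y))\<^sup>2 \<le> (norm (x k - y))\<^sup>2" "(norm (x k - x (Suc k)))\<^sup>2 \<le> (norm (x k - y))\<^sup>2"
      using sq[OF that] zero_le_power2[of "norm (x (Suc k) - y)"] zero_le_power2[of "norm (x k - x (Suc k))"]
      by linarith+
    then show "norm (x (Suc k) - y) \<le> norm (x k - y)" "norm (x (Suc k) - x k) \<le> norm (x k - y)"
      using power2_le_imp_le norm_ge_zero by (auto simp: norm_minus_commute)
  qed
  \<comment> \<open>Fejer monotonicity survives the limit: \<open>xbar\<close> is no farther from a
    common point than any iterate.\<close>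
  have limit_le: "norm (xbar - y) \<le> norm (x k - y)" if k: "k \<ge> 1" and y: "y \<in> ?V" for k y
  proof -
    have "norm (x j - y) \<le> norm (x k - y)" if "j \<ge> k" for j
      using that
    proof (induction j rule: dec_induct)
      case (step j)
      then show ?case using fejer[of j y] k y by linarith
    qed simp
    moreover have "(\<lambda>j. norm (x j - y)) \<longlonglongrightarrow> norm (xbar - y)" by (intro tendsto_intros lim)
    ultimately show ?thesis by (meson LIMSEQ_le_const2)
  qed
  have P: "(\<lambda>k. ?P i (x k)) \<longlonglongrightarrow> ?P i xbar" if "i \<in> {1..m}" for i
    by (rule isCont_tendsto_compose[OF continuous_at_closest_point lim]) (use cl cvx neU that in auto)
  have xbar: "xbar \<in> U i" if i: "i \<in> {1..m}" for i
  proof -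
    \<comment> \<open>In the limit the cut inequality for consecutive iterates becomes a bound on
      the squared distance of \<open>xbar\<close> to its own projection.\<close>
    have "(\<lambda>k. (x k - ?P i (x k)) \<bullet> (x (Suc k) - ?P i (x k))) \<longlonglongrightarrow>
      (xbar - ?P i xbar) \<bullet> (xbar - ?P i xbar)"
      by (intro tendsto_intros P i lim LIMSEQ_Suc)
    then have "(xbar - ?P i xbar) \<bullet> (xbar - ?P i xbar) \<le> 0"
      by (rule LIMSEQ_le_const2) (use inS[OF _ i] in \<open>auto simp: S_3PM_def intro!: exI[of _ 1]\<close>)
    then have "xbar = ?P i xbar"
      by (metis eq_iff_diff_eq_0 inner_eq_zero_iff inner_ge_zero order_antisym)
    then show ?thesis using closest_point_in_set[OF cl[OF i] neU[OF i]] by metis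
  qed
  have gap: "\<forall>\<^sub>F k in sequentially. dist (x (Suc k)) (?P i (x (Suc k))) \<le> \<epsilon> * norm (x (Suc k) - x k)"
    if \<epsilon>: "\<epsilon> > 0" and i: "i \<in> {1..m}" for \<epsilon> i
  proof (cases "i \<in> I")
    \<comment> \<open>Here the iterates eventually enter \<open>U i\<close>, so the distance is
      zero.\<close>
    case False
    then have "xbar \<in> interior (U i)" using I i by blast
    then have "\<forall>\<^sub>F k in sequentially. x (Suc k) \<in> interior (U i)"
      using topological_tendstoD[OF LIMSEQ_Suc[OF lim] open_interior] by blast
    then show ?thesis
    proof eventually_elim
      case (elim k)
      then have "x (Suc k) \<in> U i" using interior_subset by blast
      then show ?case using \<epsilon> by (simp add: closest_point_self)
    qed
  next
    case True
    \<comment> \<open>Outside \<open>U i\<close> the vector \<open>x k - ?P i (x k)\<close> is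
      nonzero, so its \<open>sgn\<close> is a true unit normal; shifting by \<open>N\<close> secures
      this for all indices.\<close>
    obtain N where N: "\<And>k. k \<ge> N \<Longrightarrow> x k \<notin> U i"
      using assms(9) True unfolding eventually_sequentially by blast
    define n where "n k = sgn (x k - ?P i (x k))" for k
    have "?P i xbar = xbar" using xbar[OF i] by (rule closest_point_self)
    then have q: "(\<lambda>k. ?P i (x (k + N))) \<longlonglongrightarrow> xbar"
      using LIMSEQ_ignore_initial_segment[OF P[OF i], of N] by simp
    have fr: "xbar \<in> frontier (U i)"
      using xbar[OF i] True I closure_subset by (auto simp: frontier_def)
    have n1: "norm (n (k + N)) = 1" for k
      using N[of "k + N"] closest_point_in_set[OF cl[OF i] neU[OF i], of "x (k + N)"]
      by (auto simp: n_def norm_sgn)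
    have n2: "n (k + N) \<bullet> (y - ?P i (x (k + N))) \<le> 0" if "y \<in> U i" for k y
      unfolding n_def by (rule closest_point_unit_normal_le) (use cl cvx i that in auto)
    obtain u where "(\<lambda>k. n (k + N)) \<longlonglongrightarrow> u"
      using unit_normals_tendsto[OF assms(5)[OF i] cl[OF i] intU[OF i] fr q n1 n2] by blast
    then have "n \<longlonglongrightarrow> u" by (rule LIMSEQ_offset)
    \<comment> \<open>Only the vanishing of consecutive differences is taken from the limit; the
      value of \<open>u\<close> is irrelevant.\<close>
    then have "(\<lambda>k. n (Suc k) - n k) \<longlonglongrightarrow> 0"
      using tendsto_diff[OF LIMSEQ_Suc] by fastforce
    then have "\<forall>\<^sub>F k in sequentially. norm (n (Suc k) - n k) < \<epsilon>"
      using \<epsilon> by (auto simp: tendsto_iff)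
    then show ?thesis
      using eventually_ge_at_top[of N] eventually_ge_at_top[of 1]
    proof eventually_elim
      case (elim k)
      have "dist (x (Suc k)) (?P i (x (Suc k))) \<le> norm (n (Suc k) - n k) * norm (x (Suc k) - x k)"
        unfolding n_def
        by (rule dist_closest_point_step) (use cl cvx neU i N inS elim in auto)
      also have "\<dots> \<le> \<epsilon> * norm (x (Suc k) - x k)" using elim by (intro mult_right_mono) auto
      finally show ?case .
    qed
  qed
  show ?thesis
    unfolding superlinearly_convergent_def
  proof (intro allI impI)
    fix \<eta> :: real assume \<eta>: "\<eta> > 0"
    define L where "L = norm (xbar - z) + 1"
    have L: "L > 0" by (simp add: L_def add_nonneg_pos)
    \<comment> \<open>Chosen so that \<open>2 * (\<epsilon> / r) * L = \<eta>\<close>: the 2 comes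
      from the triangle inequality through \<open>y\<close>, and \<open>L / r\<close> from linear
      regularity.\<close>
    define \<epsilon> where "\<epsilon> = \<eta> * r / (2 * L)"
    have \<epsilon>: "\<epsilon> > 0" using \<eta> r L by (simp add: \<epsilon>_def)
    have "\<forall>\<^sub>F k in sequentially. \<forall>i\<in>{1..m}.
        dist (x (Suc k)) (?P i (x (Suc k))) \<le> \<epsilon> * norm (x (Suc k) - x k)"
      using gap[OF \<epsilon>] by (intro eventually_ball_finite) auto
    moreover have "\<forall>\<^sub>F k in sequentially. norm (x (Suc k) - z) < L"
    proof -
      have "(\<lambda>k. norm (x (Suc k) - z)) \<longlonglongrightarrow> norm (xbar - z)"
        by (intro tendsto_intros LIMSEQ_Suc lim)
      then show ?thesis by (rule order_tendstoD) (simp add: L_def)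
    qed
    ultimately show "\<forall>\<^sub>F k in sequentially. norm (x (Suc k) - xbar) \<le> \<eta> * norm (x k - xbar)"
      using eventually_ge_at_top[of 1]
    proof eventually_elim
      case (elim k)
      define \<delta> where "\<delta> = \<epsilon> * norm (x (Suc k) - x k)"
      have \<delta>: "\<delta> \<ge> 0" using \<epsilon> by (simp add: \<delta>_def)
      obtain y where y: "y \<in> ?V" "norm (x (Suc k) - y) \<le> \<delta> / r * norm (x (Suc k) - z)"
        using linear_regularity[of "{1..m}" U r z \<delta> "x (Suc k)"] cvx cl r \<delta> elim(1)
        unfolding \<delta>_def by metis
      have "norm (x (Suc k) - xbar) \<le> norm (x (Suc k) - y) + norm (xbar - y)"
        by (metis dist_norm dist_triangle2)
      \<comment> \<open>By \<open>limit_le\<close> at index \<open>Suc k\<close>,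
        \<open>xbar\<close> is as close to \<open>y\<close> as the new iterate.\<close>
      also have "\<dots> \<le> 2 * norm (x (Suc k) - y)" using limit_le[OF _ y(1), of "Suc k"] by simp
      also have "\<dots> \<le> 2 * (\<delta> / r * L)"
        using y(2) elim(2) \<delta> r(1) mult_left_mono[of "norm (x (Suc k) - z)" L "\<delta> / r"] by simp
      also have "\<dots> = \<eta> * norm (x (Suc k) - x k)"
        using L r(1) by (simp add: \<delta>_def \<epsilon>_def)
      \<comment> \<open>The limit is itself a common point, so \<open>move\<close> applies with
        \<open>y = xbar\<close>.\<close>
      also have "\<dots> \<le> \<eta> * norm (x k - xbar)"
        using move[of k xbar] elim xbar \<eta> by simp
      finally show ?case .
    qed
  qed
qed

end
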